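(* Let $\Gamma = \{ g_1 = 1, g_2, \ldots, g_n \}$ be a finite abelian group of order $n$, let $R$ be the polynomial ring over $\mathbb{C}$ in indeterminates $x_g$ ($g \in \Gamma$), and let $K_\Gamma$ be the complete graph with $n$ loops on the vertex set $\Gamma$. Let the arc weights be given by the group matrix $\mathbf{M}(\Gamma) = (x_{g_i^{-1} g_j})_{1 \le i,j \le n}$, i.e. $w(e) = x_{g^{-1}h}$ for every arc $e$ from $g$ to $h$. Then the second weighted zeta function of $K_\Gamma$ satisfies $$ \mathbf{Z}_1(K_\Gamma, w, u)^{-1} = (1-u^2)^{n(n-1)/2} \prod_{\chi} \left( 1 - 2x_1 u - u \sum_{g \neq 1} \chi(g) x_g + u^2 \Big( \sum_{g \in \Gamma} x_g + x_1 - 1 \Big) \right), $$ where $\chi$ runs over all (complex, one-dimensional) characters of $\Gamma$.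
   Context: The graph $K_\Gamma$ has vertex set $\Gamma$, exactly one edge joining each pair of distinct vertices, and exactly one loop at each vertex, so it has $m = n(n+1)/2$ edges. Its arc set $D(K_\Gamma)$ has $2m$ elements: each edge (including each loop) gives two mutually inverse arcs $e \neq e^{-1}$. An edge joining $g \neq h$ gives the arcs $(g,h)$ and $(h,g)$; a loop at $g$ gives two distinct arcs $e, e^{-1}$ from $g$ to $g$, both of weight $x_1$. For an arc $e$, $o(e)$ denotes its origin and $t(e)$ its terminus. Define $2m \times 2m$ matrices indexed by arcs: $\mathbf{B}_w = (B^{(w)}_{ef})$ with $B^{(w)}_{ef} = w(f)$ if $t(e) = o(f)$ and $0$ otherwise; $\mathbf{J}_0 = (J_{ef})$ with $J_{ef} = 1$ if $f = e^{-1}$ and $0$ otherwise. The second weighted zeta function is $$\mathbf{Z}_1(K_\Gamma, w, u) = \det\left(\mathbf{I}_{2m} - u(\mathbf{B}_w - \mathbf{J}_0)\right)^{-1},$$ with $u$ an indeterminate. *)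

theory Defs
  imports
    "HOL-Algebra.Multiplicative_Group"
    "HOL-Library.Poly_Mapping"
    "HOL-Computational_Algebra.Polynomial_Factorial"
    "Jordan_Normal_Form.Determinant"
begin

section \<open>The complete graph with one loop at every vertex\<close>

text \<open>An edge \<open>{g, h}\<close> with \<open>g \<noteq> h\<close> gives the arcs \<open>Link g h\<close> and \<open>Link h g\<close>; the loop at \<open>g\<close>
  gives the two distinct, mutually inverse arcs \<open>Loop g True\<close> and \<open>Loop g False\<close>.\<close>

datatype 'a arc = Link 'a 'a | Loop 'a bool

fun origin :: "'a arc \<Rightarrow> 'a" where
  "origin (Link g h) = g"
| "origin (Loop g b) = g"

fun terminus :: "'a arc \<Rightarrow> 'a" where
  "terminus (Link g h) = h"
| "terminus (Loop g b) = g"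

fun arc_inv :: "'a arc \<Rightarrow> 'a arc" where
  "arc_inv (Link g h) = Link h g"
| "arc_inv (Loop g b) = Loop g (\<not> b)"

definition arcs :: "'a set \<Rightarrow> 'a arc set" where
  "arcs V = {Link g h | g h. g \<in> V \<and> h \<in> V \<and> g \<noteq> h} \<union> {Loop g b | g b. g \<in> V}"

lemma card_arcs:
  assumes "finite V"
  shows "card (arcs V) = 2 * (card V * (card V + 1) div 2)"
proof -
  let ?L = "(\<lambda>(g, h). Link g h) ` (V \<times> V - (\<lambda>g. (g, g)) ` V)"
  let ?O = "(\<lambda>(g, b). Loop g b) ` (V \<times> (UNIV :: bool set))"
  have eq: "arcs V = ?L \<union> ?O"
    unfolding arcs_def by (auto simp: image_iff)
  have "card ?L = card (V \<times> V - (\<lambda>g. (g, g)) ` V)"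
    by (rule card_image) (auto simp: inj_on_def)
  also have "\<dots> = card V * card V - card V"
    using assms by (subst card_Diff_subset) (auto simp: card_cartesian_product card_image inj_on_def)
  finally have L: "card ?L = card V * card V - card V" .
  have "card ?O = card (V \<times> (UNIV :: bool set))"
    by (rule card_image) (auto simp: inj_on_def)
  then have O: "card ?O = 2 * card V"
    by (simp add: card_cartesian_product)
  have "card (arcs V) = card ?L + card ?O"
    unfolding eq using assms by (intro card_Un_disjoint) auto
  also have "\<dots> = card V * (card V + 1)"
    unfolding L O by (cases "card V") (auto simp: algebra_simps)
  finally show ?thesis by simp
qed

section \<open>The second weighted zeta function\<close>

text \<open>Matrices indexed by arcs are written with respect to an enumeration \<open>es\<close> of the arcs
  (a list of all arcs without repetition); the determinant does not depend on it.\<close>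

definition arc_matrix :: "'a arc list \<Rightarrow> ('a arc \<Rightarrow> 'a arc \<Rightarrow> 'r) \<Rightarrow> 'r mat" where
  "arc_matrix es F = mat (length es) (length es) (\<lambda>(i, j). F (es ! i) (es ! j))"

definition B_mat :: "'a arc list \<Rightarrow> ('a arc \<Rightarrow> 'r) \<Rightarrow> 'r :: comm_ring_1 mat" where
  "B_mat es w = arc_matrix es (\<lambda>e f. if terminus e = origin f then w f else 0)"

definition J0_mat :: "'a arc list \<Rightarrow> 'r :: comm_ring_1 mat" where
  "J0_mat es = arc_matrix es (\<lambda>e f. if f = arc_inv e then 1 else 0)"

text \<open>For weights in an integral domain \<open>R\<close>, the zeta function is an element of the field of
  fractions of \<open>R[u]\<close>. The determinant inverted has constant coefficient \<open>1\<close>, hence is nonzero.\<close>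

definition uvar :: "'r :: comm_ring_1 poly" where
  "uvar = [:0, 1:]"

definition Z1 :: "'a arc list \<Rightarrow> ('a arc \<Rightarrow> 'r) \<Rightarrow> 'r :: idom poly fract" where
  "Z1 es w = inverse (to_fract (det
     (1\<^sub>m (length es) - uvar \<cdot>\<^sub>m map_mat (\<lambda>c. [:c:]) (B_mat es w - J0_mat es))))"

section \<open>The polynomial ring and the group matrix weights\<close>

text \<open>Complex polynomials in indeterminates \<open>X\<^sub>0, X\<^sub>1, \<dots>\<close>. Given an enumeration
  \<open>g 1, \<dots>, g n\<close> of a group, the indeterminate attached to the element \<open>g i\<close> is \<open>X\<^sub>i\<close>.
  Indexing by natural numbers rather than by group elements makes the ring an instance of
  \<open>idom\<close>, since the library's instance needs linearly ordered indices.\<close>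

type_synonym cpoly = "(nat \<Rightarrow>\<^sub>0 nat) \<Rightarrow>\<^sub>0 complex"

definition indet :: "nat \<Rightarrow> cpoly" where
  "indet i = Poly_Mapping.single (Poly_Mapping.single i 1) 1"

definition const :: "complex \<Rightarrow> cpoly" where
  "const c = Poly_Mapping.single 0 c"

definition group_indet :: "(nat \<Rightarrow> 'a) \<Rightarrow> nat \<Rightarrow> 'a \<Rightarrow> cpoly" where
  "group_indet g n h = indet (inv_into {1..n} g h)"

definition group_weight :: "('a, 'm) monoid_scheme \<Rightarrow> ('a \<Rightarrow> 'r) \<Rightarrow> 'a arc \<Rightarrow> 'r" where
  "group_weight G x e = x (inv\<^bsub>G\<^esub> (origin e) \<otimes>\<^bsub>G\<^esub> terminus e)"

section \<open>Characters\<close>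

definition complex_mult_group :: "complex monoid" where
  "complex_mult_group = \<lparr>carrier = - {0}, monoid.mult = (*), one = 1\<rparr>"

text \<open>Restricting to extensional functions makes each character occur exactly once.\<close>

definition characters :: "('a, 'm) monoid_scheme \<Rightarrow> ('a \<Rightarrow> complex) set" where
  "characters G = hom G complex_mult_group \<inter> extensional (carrier G)"

lemma finite_characters:
  assumes "group G" and fin: "finite (carrier G)"
  shows "finite (characters G)"
proof -
  interpret group G by fact
  let ?N = "Coset.order G"
  have N: "?N > 0"
    using fin order_gt_0_iff_finite by blast
  have "characters G \<subseteq> carrier G \<rightarrow>\<^sub>E {z :: complex. z ^ ?N = 1}"
  proof
    fix \<chi> assume \<chi>: "\<chi> \<in> characters G"
    then have h: "\<chi> \<in> hom G complex_mult_group" and ext: "\<chi> \<in> extensional (carrier G)"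
      by (auto simp: characters_def)
    have mult: "\<chi> (a \<otimes>\<^bsub>G\<^esub> b) = \<chi> a * \<chi> b" if "a \<in> carrier G" "b \<in> carrier G" for a b
      using h that by (auto simp: hom_def complex_mult_group_def)
    have nz: "\<chi> a \<noteq> 0" if "a \<in> carrier G" for a
      using h that by (auto simp: hom_def complex_mult_group_def)
    have one: "\<chi> \<one>\<^bsub>G\<^esub> = 1"
      using mult[of "\<one>\<^bsub>G\<^esub>" "\<one>\<^bsub>G\<^esub>"] nz[of "\<one>\<^bsub>G\<^esub>"] by simp
    have pow: "\<chi> (a [^]\<^bsub>G\<^esub> k) = \<chi> a ^ k" if a: "a \<in> carrier G" for a and k :: nat
      by (induction k) (simp_all add: one mult a)
    have "\<chi> a ^ ?N = 1" if a: "a \<in> carrier G" for a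
      using pow[OF a, of ?N] pow_order_eq_1[OF a] one by simp
    with ext show "\<chi> \<in> carrier G \<rightarrow>\<^sub>E {z :: complex. z ^ ?N = 1}"
      by (auto simp: PiE_def)
  qed
  moreover have "finite {z :: complex. z ^ ?N = 1}"
    using N by (intro finite_roots_unity) simp
  ultimately show ?thesis
    using fin by (meson finite_PiE finite_subset)
qed

end

theory Submission
  imports Defs
begin

text \<open>
  The reciprocal of the zeta function is a determinant of size \<open>n (n + 1)\<close> indexed by arcs. It is
  evaluated in two steps.

  The first step does not use the group structure. It is a weighted form of Bass's formula
  (\<open>bass_formula\<close>, \<open>bass_formula_complete_graph\<close>). The matrix \<open>B\<close> factors through the vertices,
  \<open>B = K L\<close>, since its entries only depend on whether one arc ends where the other begins. After
  multiplication by \<open>I - u J\<close>, whose determinant is \<open>(1 - u\<^sup>2)\<^sup>m\<close> (\<open>det_involution_matrix\<close>), the arc matrix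
  becomes \<open>1 - u\<^sup>2\<close> minus a product through the vertices, and the Sylvester identity \<open>det_sylvester\<close>
  replaces it by the \<open>n \<times> n\<close> matrix \<open>(1 - u\<^sup>2) I - u W + u\<^sup>2 D\<close>. Here \<open>W\<close> contains the total weights between
  vertices and \<open>D\<close> the total weights leaving each vertex. Everything is arranged as
  identities in an integral domain, where the surplus factors \<open>1 - u\<^sup>2\<close> cancel.

  The second step uses that for the weights \<open>x\<close> of a group matrix the entries of this \<open>n \<times> n\<close> matrix at \<open>(v, v')\<close>
  depend only on \<open>v\<^sup>-\<^sup>1 v'\<close>. So it is itself a group matrix, and Dedekind's theorem
  (\<open>det_group_matrix\<close>) diagonalizes it by the character table. The eigenvalue for \<open>\<chi>\<close> is the factor for
  \<open>\<chi>\<close> in the claim. Cancelling the determinant of the character table requires that there are exactly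
  \<open>n\<close> characters (\<open>card_characters\<close>); this follows from orthogonality once characters separate
  points, and the separating characters are found as eigenvalue systems of common eigenfunctions of
  the translations (\<open>ex_common_eigenfunction\<close>).
\<close>

section \<open>Matrices indexed by lists and the Sylvester identity\<close>

text \<open>Rows and columns are labelled by lists of objects (arcs, vertices, group elements,
  characters). When the inner list has no repetition, a matrix product becomes a sum over a set of
  labels, and the computations below are about functions of labels rather than about positions.\<close>

definition matrix_on :: "'i list \<Rightarrow> 'j list \<Rightarrow> ('i \<Rightarrow> 'j \<Rightarrow> 'r) \<Rightarrow> 'r mat" where
  "matrix_on xs ys F = mat (length xs) (length ys) (\<lambda>(i, j). F (xs ! i) (ys ! j))"

lemma matrix_on_carrier [simp]: "matrix_on xs ys F \<in> carrier_mat (length xs) (length ys)"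
  by (simp add: matrix_on_def)

lemma matrix_on_cong:
  assumes "\<And>x y. x \<in> set xs \<Longrightarrow> y \<in> set ys \<Longrightarrow> F x y = G x y"
  shows "matrix_on xs ys F = matrix_on xs ys G"
  using assms by (auto simp: matrix_on_def intro!: eq_matI)

lemma sum_nth_distinct:
  assumes "distinct ys"
  shows "(\<Sum>k = 0..<length ys. f (ys ! k)) = sum f (set ys)"
  by (rule sum.reindex_bij_betw) (use assms in \<open>auto intro: bij_betw_nth\<close>)

lemma prod_nth_distinct:
  assumes "distinct ys"
  shows "(\<Prod>k = 0..<length ys. f (ys ! k)) = prod f (set ys)"
  by (rule prod.reindex_bij_betw) (use assms in \<open>auto intro: bij_betw_nth\<close>)

lemma matrix_on_mult:
  fixes F :: "'i \<Rightarrow> 'j \<Rightarrow> 'r :: comm_ring_1"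
  assumes "distinct ys"
  shows "matrix_on xs ys F * matrix_on ys zs G
    = matrix_on xs zs (\<lambda>x z. \<Sum>y\<in>set ys. F x y * G y z)"
  by (rule eq_matI) (auto simp: matrix_on_def scalar_prod_def
      sum_nth_distinct[OF assms, of "\<lambda>y. F _ y * G y _"])

lemma det_matrix_on_diagonal:
  fixes c :: "'i \<Rightarrow> 'r :: idom"
  assumes "distinct xs"
  shows "det (matrix_on xs xs (\<lambda>x y. if x = y then c x else 0)) = (\<Prod>x\<in>set xs. c x)"
proof -
  let ?D = "matrix_on xs xs (\<lambda>x y. if x = y then c x else 0)"
  have "det ?D = prod_list (diag_mat ?D)"
    by (rule det_upper_triangular[of _ "length xs"])
      (use assms in \<open>auto simp: matrix_on_def nth_eq_iff_index_eq\<close>)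
  also have "\<dots> = (\<Prod>k = 0..<length xs. c (xs ! k))"
    by (simp add: prod_list_diag_prod matrix_on_def)
  finally show ?thesis
    by (simp add: prod_nth_distinct[OF assms])
qed

lemma det_matrix_on_mult:
  fixes F :: "'i \<Rightarrow> 'j \<Rightarrow> 'r :: comm_ring_1"
  assumes "distinct ys" "length xs = length ys"
  shows "det (matrix_on xs ys F) * det (matrix_on ys xs G)
    = det (matrix_on xs xs (\<lambda>x z. \<Sum>y\<in>set ys. F x y * G y z))"
  using det_mult[of "matrix_on xs ys F" "length xs" "matrix_on ys xs G"]
    matrix_on_carrier[of xs ys F] matrix_on_carrier[of ys xs G] assms
  by (simp add: matrix_on_mult)

text \<open>The identity between \<open>det (a - A B)\<close> and \<open>det (a - B A)\<close>, cleared of denominators so that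
  it makes sense over an integral domain in which \<open>a\<close> is not invertible. Both sides come from the
  one block matrix \<open>[a, A; B, 1]\<close>: multiplying it on the right by \<open>[1, 0; -B, 1]\<close> clears its lower
  left block, and multiplying it by \<open>[1, -A; 0, a]\<close> clears its upper right block.\<close>

lemma det_sylvester:
  fixes A B :: "'r :: idom mat"
  assumes A: "A \<in> carrier_mat N n" and B: "B \<in> carrier_mat n N"
  shows "a ^ n * det (a \<cdot>\<^sub>m 1\<^sub>m N - A * B) = a ^ N * det (a \<cdot>\<^sub>m 1\<^sub>m n - B * A)"
proof -
  let ?Q = "four_block_mat (a \<cdot>\<^sub>m 1\<^sub>m N) A B (1\<^sub>m n)"
  let ?L = "four_block_mat (1\<^sub>m N) (0\<^sub>m N n) (- B) (1\<^sub>m n)"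
  let ?U = "four_block_mat (1\<^sub>m N) (- A) (0\<^sub>m n N) (a \<cdot>\<^sub>m 1\<^sub>m n)"
  have Q: "?Q \<in> carrier_mat (N + n) (N + n)" and L: "?L \<in> carrier_mat (N + n) (N + n)"
    and U: "?U \<in> carrier_mat (N + n) (N + n)"
    by auto
  have "?Q * ?L = four_block_mat (a \<cdot>\<^sub>m 1\<^sub>m N - A * B) A (0\<^sub>m n N) (1\<^sub>m n)"
    by (subst mult_four_block_mat[of _ N N _ n _ n _ _ N _ n], use A B in simp_all)
      (intro cong_four_block_mat eq_matI, use A B in \<open>auto\<close>)
  then have 1: "det ?Q * det ?L = det (a \<cdot>\<^sub>m 1\<^sub>m N - A * B)"
    using A B by (subst det_mult[OF Q L, symmetric])
      (simp, subst det_four_block_mat_lower_left_zero[of _ N _ n], auto)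
  have 2: "det ?L = 1"
    using B by (subst det_four_block_mat_upper_right_zero[of _ N _ n]) auto
  have "?Q * ?U = four_block_mat (a \<cdot>\<^sub>m 1\<^sub>m N) (0\<^sub>m N n) B (a \<cdot>\<^sub>m 1\<^sub>m n - B * A)"
    by (subst mult_four_block_mat[of _ N N _ n _ n _ _ N _ n], use A B in simp_all)
      (intro cong_four_block_mat eq_matI, use A B in \<open>auto\<close>)
  then have 3: "det ?Q * det ?U = a ^ N * det (a \<cdot>\<^sub>m 1\<^sub>m n - B * A)"
    using A B by (subst det_mult[OF Q U, symmetric])
      (simp, subst det_four_block_mat_upper_right_zero[of _ N _ n], auto)
  have 4: "det ?U = a ^ n"
    using A by (subst det_four_block_mat_lower_left_zero[of _ N _ n]) auto
  from 1 2 3 4 show ?thesis by (simp add: mult.commute)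
qed

lemma poly_det:
  fixes A :: "'a :: comm_ring_1 poly mat"
  shows "poly (det A) a = det (map_mat (\<lambda>p. poly p a) A)"
proof -
  interpret comm_ring_hom "\<lambda>p. poly p a"
    by unfold_locales auto
  show ?thesis by simp
qed

section \<open>Bass's formula for weighted arcs\<close>

text \<open>A sign that singles out one element of each pair \<open>{e, \<sigma> e}\<close>: compare the labels of an
  injective numbering. For arcs this is a choice of orientation of every edge.\<close>

lemma finite_alternating_sign:
  assumes "finite E" and inv: "\<And>e. e \<in> E \<Longrightarrow> \<sigma> e \<in> E \<and> \<sigma> (\<sigma> e) = e \<and> \<sigma> e \<noteq> e"
  obtains s :: "'e \<Rightarrow> 'r :: comm_ring_1"
  where "\<And>e. e \<in> E \<Longrightarrow> s (\<sigma> e) = - s e" "\<And>e. s e * s e = 1"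
proof -
  obtain pos :: "'e \<Rightarrow> nat" where pos: "inj_on pos E"
    using finite_imp_inj_to_nat_seg[OF assms(1)] by blast
  show ?thesis
  proof
    show "(if pos (\<sigma> e) < pos (\<sigma> (\<sigma> e)) then 1 else - 1 :: 'r)
        = - (if pos e < pos (\<sigma> e) then 1 else - 1)" if "e \<in> E" for e
      using inv[OF that] inj_onD[OF pos, of e "\<sigma> e"] that by fastforce
  qed auto
qed

text \<open>The effect of multiplying a row \<open>c\<close> by \<open>I - t J\<close>, where \<open>J\<close> is the permutation matrix of the
  involution \<open>\<sigma>\<close>.\<close>

lemma sum_involution_column:
  fixes c :: "'e \<Rightarrow> 'r :: comm_ring_1"
  assumes E: "finite E" and inv: "\<And>e. e \<in> E \<Longrightarrow> \<sigma> e \<in> E \<and> \<sigma> (\<sigma> e) = e" and g: "g \<in> E"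
  shows "(\<Sum>f\<in>E. c f * ((if f = g then 1 else 0) - t * (if g = \<sigma> f then 1 else 0)))
    = c g - t * c (\<sigma> g)"
proof -
  have "(\<Sum>f\<in>E. c f * ((if f = g then 1 else 0) - t * (if g = \<sigma> f then 1 else 0)))
      = (\<Sum>f\<in>E. (if f = g then c f else 0) - (if f = \<sigma> g then t * c f else 0))"
  proof (rule sum.cong[OF refl])
    fix f assume "f \<in> E"
    then have "g = \<sigma> f \<longleftrightarrow> f = \<sigma> g"
      using inv g by metis
    then show "c f * ((if f = g then 1 else 0) - t * (if g = \<sigma> f then 1 else 0))
        = (if f = g then c f else 0) - (if f = \<sigma> g then t * c f else 0)"
      by (simp add: algebra_simps)
  qed
  also have "\<dots> = c g - t * c (\<sigma> g)"
    using E g inv[OF g] by (simp add: sum_subtractf)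
  finally show ?thesis .
qed

text \<open>Write \<open>d(u) = det (I - u J)\<close>, where \<open>J\<close> is the permutation matrix of an involution
  without fixed points on \<open>2 m\<close> labels. Reordering the labels into pairs would give \<open>2 \<times> 2\<close> blocks;
  the following argument needs no reordering. Conjugation with the diagonal matrix of alternating
  signs turns \<open>J\<close> into \<open>- J\<close>, so \<open>d(- u) = d(u)\<close>. Since \<open>J\<^sup>2 = I\<close>, it follows that
  \<open>d(u)\<^sup>2 = det ((1 - u\<^sup>2) I) = (1 - u\<^sup>2)\<^bsup>2m\<^esup>\<close>. In an integral domain this fixes \<open>d(u)\<close> up to a sign,
  and the sign is read off from the constant coefficient, which is \<open>1\<close>.\<close>

lemma det_involution_matrix:
  fixes u :: "'r :: idom poly"
  assumes es: "distinct es" "length es = 2 * m"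
    and inv: "\<And>e. e \<in> set es \<Longrightarrow> \<sigma> e \<in> set es \<and> \<sigma> (\<sigma> e) = e \<and> \<sigma> e \<noteq> e"
    and u0: "poly u 0 = 0"
  shows "det (matrix_on es es (\<lambda>e f. (if e = f then 1 else 0) - u * (if f = \<sigma> e then 1 else 0)))
    = (1 - u ^ 2) ^ m"
proof -
  let ?N = "\<lambda>t e f. (if e = f then 1 else 0) - t * (if f = \<sigma> e then 1 else 0)"
  let ?d = "\<lambda>t. det (matrix_on es es (?N t))"
  obtain s :: "_ \<Rightarrow> 'r poly" where s: "\<And>e. e \<in> set es \<Longrightarrow> s (\<sigma> e) = - s e" "\<And>e. s e * s e = 1"
    using finite_alternating_sign[OF finite_set inv] by metis
  let ?S = "matrix_on es es (\<lambda>e f. if e = f then s e else 0)"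
  have conj: "det ?S * ?d u * det ?S = ?d (- u)"
  proof -
    have "det ?S * ?d u * det ?S = det (matrix_on es es (\<lambda>e f. s e * ?N u e f * s f))"
      using es(1) by (simp add: det_matrix_on_mult
          if_distrib[of "\<lambda>c. c * _"] if_distrib[of "\<lambda>c. _ * c"] cong: if_cong matrix_on_cong)
    also have "matrix_on es es (\<lambda>e f. s e * ?N u e f * s f) = matrix_on es es (?N (- u))"
    proof (rule matrix_on_cong)
      fix e f assume "e \<in> set es" "f \<in> set es"
      with s inv[of e] show "s e * ?N u e f * s f = ?N (- u) e f"
        by (auto simp: algebra_simps)
    qed
    finally show ?thesis .
  qed
  have S: "det ?S * det ?S = 1"
    using es(1) s(2) by (simp add: det_matrix_on_diagonal flip: prod.distrib)
  have "?d u * ?d (- u) = det (matrix_on es es (\<lambda>e f. \<Sum>h\<in>set es. ?N u e h * ?N (- u) h f))"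
    using es(1) by (rule det_matrix_on_mult) simp
  also have "matrix_on es es (\<lambda>e f. \<Sum>h\<in>set es. ?N u e h * ?N (- u) h f)
      = matrix_on es es (\<lambda>e f. if e = f then 1 - u ^ 2 else 0)"
  proof (rule matrix_on_cong)
    fix e f assume ef: "e \<in> set es" "f \<in> set es"
    have "(\<Sum>h\<in>set es. ?N u e h * ?N (- u) h f) = ?N u e f - (- u) * ?N u e (\<sigma> f)"
      using inv ef(2) by (intro sum_involution_column) auto
    also have "\<dots> = (if e = f then 1 - u ^ 2 else 0)"
    proof -
      have "f = \<sigma> e \<longleftrightarrow> e = \<sigma> f" "\<sigma> f = \<sigma> e \<longleftrightarrow> e = f"
        using inv ef by metis+
      then show ?thesis
        using inv[OF ef(1)] inv[OF ef(2)] by (auto simp: power2_eq_square)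
    qed
    finally show "(\<Sum>h\<in>set es. ?N u e h * ?N (- u) h f) = (if e = f then 1 - u ^ 2 else 0)" .
  qed
  also have "det \<dots> = ((1 - u ^ 2) ^ m) ^ 2"
    using es by (simp add: det_matrix_on_diagonal distinct_card power_mult[symmetric] mult.commute)
  finally have "?d u * ?d (- u) = ((1 - u ^ 2) ^ m) ^ 2" .
  moreover have "?d (- u) = ?d u"
  proof -
    have "?d (- u) = (det ?S * det ?S) * ?d u"
      unfolding conj[symmetric] by (simp only: mult_ac)
    then show ?thesis
      unfolding S by simp
  qed
  ultimately have "(?d u) ^ 2 = ((1 - u ^ 2) ^ m) ^ 2"
    by (simp add: power2_eq_square)
  then have cases: "?d u = (1 - u ^ 2) ^ m \<or> ?d u = - ((1 - u ^ 2) ^ m)"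
    by (simp add: power2_eq_iff)
  have "map_mat (\<lambda>p. poly p 0) (matrix_on es es (?N u)) = 1\<^sub>m (length es)"
    using es(1) u0 by (intro eq_matI) (auto simp: matrix_on_def nth_eq_iff_index_eq)
  then have "poly (?d u) 0 = 1"
    by (simp add: poly_det)
  moreover have "poly ((1 - u ^ 2) ^ m) 0 = 1"
    using u0 by simp
  ultimately have const: "?d u = - ((1 - u ^ 2) ^ m) \<Longrightarrow> (1 :: 'r) = - 1"
    by (metis poly_minus)
  \<comment> \<open>The wrong sign could only occur in characteristic two, where it is the right one.\<close>
  have "?d u = (1 - u ^ 2) ^ m" if "?d u = - ((1 - u ^ 2) ^ m)"
  proof -
    have "(1 :: 'r poly) = - 1"
      using const[OF that] by (simp add: one_pCons)
    then show ?thesis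
      using that by (metis mult_1 mult_minus_left)
  qed
  then show ?thesis
    using cases by blast
qed

lemma arc_inv_simps [simp]:
  "arc_inv (arc_inv e) = e" "origin (arc_inv e) = terminus e" "terminus (arc_inv e) = origin e"
  by (cases e; simp)+

text \<open>The determinant over arcs reduces to one over vertices. Let \<open>K\<close> be the arc-vertex
  matrix of termini and \<open>L\<close> the vertex-arc matrix with entry \<open>W f\<close> at the origin of \<open>f\<close>, so that
  \<open>B = K L\<close>. The matrix \<open>I - u (B - J)\<close> equals \<open>(I + u J) - u K L\<close>; multiplying it on the right by
  \<open>I - u J\<close>, whose determinant is known, gives \<open>(1 - u\<^sup>2) I - K L'\<close> with \<open>L' = u L (I - u J)\<close>.
  The Sylvester identity exchanges the factors, and \<open>L' K = u L K - u\<^sup>2 L J K\<close>. Here \<open>L K\<close> collects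
  the weights of the arcs between two given vertices, and \<open>L J K\<close> is diagonal and collects the
  weights of the arcs leaving a vertex. All factors \<open>1 - u\<^sup>2\<close> stay on the side where their exponent
  is nonnegative.\<close>

lemma bass_formula:
  fixes u :: "'r :: idom poly" and W :: "'a arc \<Rightarrow> 'r poly"
  assumes es: "distinct es" "length es = 2 * m"
    and inv: "\<And>e. e \<in> set es \<Longrightarrow> arc_inv e \<in> set es \<and> arc_inv e \<noteq> e"
    and vs: "distinct vs" "origin ` set es \<subseteq> set vs"
    and u0: "poly u 0 = 0"
  shows "(1 - u ^ 2) ^ length vs *
      det (matrix_on es es (\<lambda>e f. (if e = f then 1 else 0)
        - u * ((if terminus e = origin f then W f else 0) - (if f = arc_inv e then 1 else 0))))
    = (1 - u ^ 2) ^ m *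
      det (matrix_on vs vs (\<lambda>v v'.
        (if v = v' then 1 - u ^ 2 + u ^ 2 * (\<Sum>e | e \<in> set es \<and> origin e = v. W e) else 0)
        - u * (\<Sum>e | e \<in> set es \<and> origin e = v \<and> terminus e = v'. W e)))"
proof -
  let ?a = "1 - u ^ 2"
  let ?A = "\<lambda>e f. (if e = f then 1 else 0)
        - u * ((if terminus e = origin f then W f else 0) - (if f = arc_inv e then 1 else 0))"
  let ?N = "\<lambda>e f. (if e = f then 1 else 0) - u * (if f = arc_inv e then 1 else 0)"
  let ?K = "\<lambda>e v. if terminus e = v then 1 else 0 :: 'r poly"
  \<comment> \<open>The entries of \<open>L'\<close>; the arc \<open>arc_inv f\<close> starts where \<open>f\<close> ends.\<close>
  let ?L = "\<lambda>v f. u * (if origin f = v then W f else 0)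
      - u ^ 2 * (if terminus f = v then W (arc_inv f) else 0)"
  let ?M = "\<lambda>v v'. (if v = v' then ?a + u ^ 2 * (\<Sum>e | e \<in> set es \<and> origin e = v. W e) else 0)
        - u * (\<Sum>e | e \<in> set es \<and> origin e = v \<and> terminus e = v'. W e)"
  have term_vs: "terminus e \<in> set vs" if "e \<in> set es" for e
    using vs(2) inv[OF that] by (metis arc_inv_simps(2) image_subset_iff)
  have detN: "det (matrix_on es es ?N) = ?a ^ m"
    using es inv u0 by (intro det_involution_matrix) auto
  have "det (matrix_on es es ?A) * det (matrix_on es es ?N)
      = det (matrix_on es es (\<lambda>e g. \<Sum>f\<in>set es. ?A e f * ?N f g))"
    using es(1) by (rule det_matrix_on_mult) simp
  also have "matrix_on es es (\<lambda>e g. \<Sum>f\<in>set es. ?A e f * ?N f g)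
      = matrix_on es es (\<lambda>e g. (if e = g then ?a else 0) - (\<Sum>v\<in>set vs. ?K e v * ?L v g))"
  proof (rule matrix_on_cong)
    fix e g assume eg: "e \<in> set es" "g \<in> set es"
    have "(\<Sum>f\<in>set es. ?A e f * ?N f g) = ?A e g - u * ?A e (arc_inv g)"
      using inv eg(2) by (intro sum_involution_column) auto
    also have "\<dots> = (if e = g then ?a else 0) - ?L (terminus e) g"
    proof -
      have "g = arc_inv e \<longleftrightarrow> e = arc_inv g" "arc_inv g = arc_inv e \<longleftrightarrow> e = g"
        by (metis arc_inv_simps(1))+
      moreover have "e = g \<Longrightarrow> e \<noteq> arc_inv g"
        using inv[OF eg(1)] by metis
      ultimately show ?thesis
        by (simp add: algebra_simps power2_eq_square)
    qed
    also have "?L (terminus e) g = (\<Sum>v\<in>set vs. ?K e v * ?L v g)"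
      using term_vs[OF eg(1)] by (simp add: if_distrib[of "\<lambda>c. c * _"] cong: if_cong)
    finally show "(\<Sum>f\<in>set es. ?A e f * ?N f g)
        = (if e = g then ?a else 0) - (\<Sum>v\<in>set vs. ?K e v * ?L v g)" .
  qed
  also have "\<dots> = ?a \<cdot>\<^sub>m 1\<^sub>m (length es) - matrix_on es vs ?K * matrix_on vs es ?L"
    using es(1) vs(1) unfolding matrix_on_mult[OF vs(1)]
    by (intro eq_matI) (auto simp: matrix_on_def nth_eq_iff_index_eq)
  finally have 1: "det (matrix_on es es ?A) * ?a ^ m
      = det (?a \<cdot>\<^sub>m 1\<^sub>m (length es) - matrix_on es vs ?K * matrix_on vs es ?L)"
    unfolding detN .
  have "?a \<cdot>\<^sub>m 1\<^sub>m (length vs) - matrix_on vs es ?L * matrix_on es vs ?K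
      = matrix_on vs vs (\<lambda>v v'. (if v = v' then ?a else 0) - (\<Sum>e\<in>set es. ?L v e * ?K e v'))"
    using vs(1) unfolding matrix_on_mult[OF es(1)]
    by (intro eq_matI) (auto simp: matrix_on_def nth_eq_iff_index_eq)
  also have "\<dots> = matrix_on vs vs ?M"
  proof (rule matrix_on_cong)
    fix v v'
    have "(\<Sum>e\<in>set es. ?L v e * ?K e v')
        = (\<Sum>e\<in>set es. u * (if origin e = v \<and> terminus e = v' then W e else 0)
          - u ^ 2 * (if terminus e = v \<and> v = v' then W (arc_inv e) else 0))"
    proof (rule sum.cong[OF refl])
      fix e
      show "?L v e * ?K e v' = u * (if origin e = v \<and> terminus e = v' then W e else 0)
          - u ^ 2 * (if terminus e = v \<and> v = v' then W (arc_inv e) else 0)"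
        by (cases "terminus e = v'"; cases "v = v'") simp_all
    qed
    also have "\<dots> = u * (\<Sum>e | e \<in> set es \<and> origin e = v \<and> terminus e = v'. W e)
        - u ^ 2 * (if v = v' then \<Sum>e | e \<in> set es \<and> terminus e = v. W (arc_inv e) else 0)"
    proof -
      have "(\<Sum>e\<in>set es. if origin e = v \<and> terminus e = v' then W e else 0)
          = (\<Sum>e | e \<in> set es \<and> origin e = v \<and> terminus e = v'. W e)"
        by (rule sum.inter_filter[symmetric]) simp
      moreover have "(\<Sum>e\<in>set es. if terminus e = v \<and> v = v' then W (arc_inv e) else 0)
          = (if v = v' then \<Sum>e | e \<in> set es \<and> terminus e = v. W (arc_inv e) else 0)"
        by (cases "v = v'") (simp_all add: sum.inter_filter)
      ultimately show ?thesis
        unfolding sum_subtractf sum_distrib_left[symmetric] by simp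
    qed
    also have "(\<Sum>e | e \<in> set es \<and> terminus e = v. W (arc_inv e))
        = (\<Sum>e | e \<in> set es \<and> origin e = v. W e)"
      by (rule sum.reindex_bij_witness[of _ arc_inv arc_inv]) (use inv in auto)
    finally have eq: "(\<Sum>e\<in>set es. ?L v e * ?K e v')
        = u * (\<Sum>e | e \<in> set es \<and> origin e = v \<and> terminus e = v'. W e)
          - u ^ 2 * (if v = v' then \<Sum>e | e \<in> set es \<and> origin e = v. W e else 0)" .
    show "(if v = v' then ?a else 0) - (\<Sum>e\<in>set es. ?L v e * ?K e v') = ?M v v'"
      unfolding eq by simp
  qed
  finally have 2: "?a \<cdot>\<^sub>m 1\<^sub>m (length vs) - matrix_on vs es ?L * matrix_on es vs ?K
      = matrix_on vs vs ?M" .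
  have "?a ^ length vs * (det (matrix_on es es ?A) * ?a ^ m)
      = ?a ^ (2 * m) * det (matrix_on vs vs ?M)"
    unfolding 1 2[symmetric] es(2)[symmetric]
    by (rule det_sylvester) simp_all
  then have "?a ^ m * (?a ^ length vs * det (matrix_on es es ?A))
      = ?a ^ m * (?a ^ m * det (matrix_on vs vs ?M))"
    unfolding mult_2 power_add by (simp only: mult_ac)
  moreover have "?a \<noteq> 0"
    using u0 by (metis diff_zero poly_0 poly_1 poly_diff poly_power power_zero_numeral zero_neq_one)
  ultimately show ?thesis
    by simp
qed

section \<open>The complete graph with loops\<close>

text \<open>Here \<open>2 m = n (n + 1)\<close>, so \<open>n (n - 1) / 2\<close> factors \<open>1 - u\<^sup>2\<close> remain after cancelling \<open>n\<close> of
  them. Both arcs of a loop start and end at its vertex, so \<open>X v v\<close> counts twice on the diagonal.\<close>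

lemma bass_formula_complete_graph:
  fixes u :: "'r :: idom poly" and X :: "'a \<Rightarrow> 'a \<Rightarrow> 'r poly"
  assumes es: "distinct es" "set es = arcs (set vs)" and vs: "distinct vs" and u0: "poly u 0 = 0"
  shows "det (matrix_on es es (\<lambda>e f. (if e = f then 1 else 0)
        - u * ((if terminus e = origin f then X (origin f) (terminus f) else 0)
          - (if f = arc_inv e then 1 else 0))))
    = (1 - u ^ 2) ^ (length vs * (length vs - 1) div 2) *
      det (matrix_on vs vs (\<lambda>v v'. if v = v'
        then 1 - 2 * X v v * u + u ^ 2 * ((\<Sum>h\<in>set vs. X v h) + X v v - 1)
        else - u * X v v'))" (is "?l = (1 - u ^ 2) ^ ?k * det ?R")
proof -
  let ?n = "length vs"
  let ?W = "\<lambda>e. X (origin e) (terminus e)"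
  have "length es = 2 * (?n * (?n + 1) div 2)"
    using card_arcs[OF finite_set[of vs], folded es(2)]
    by (simp only: distinct_card[OF es(1)] distinct_card[OF vs])
  also have "?n * (?n + 1) = ?n * (?n - 1) + 2 * ?n"
    by (cases ?n) auto
  also have "\<dots> div 2 = ?n + ?k"
    by simp
  finally have len: "length es = 2 * (?n + ?k)" .
  have between: "{e \<in> set es. origin e = v \<and> terminus e = v'}
      = (if v = v' then {Loop v True, Loop v False} else {Link v v'})"
    if "v \<in> set vs" "v' \<in> set vs" for v v'
    using that unfolding es(2) arcs_def by (auto split: if_splits)
  have "{e \<in> set es. origin e = v} = Link v ` (set vs - {v}) \<union> {Loop v True, Loop v False}"
    if "v \<in> set vs" for v
    using that unfolding es(2) arcs_def by (auto split: if_splits)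
  then have out: "(\<Sum>e | e \<in> set es \<and> origin e = v. ?W e) = (\<Sum>h\<in>set vs. X v h) + X v v"
    if "v \<in> set vs" for v
    using that by (simp add: sum.reindex inj_on_def image_iff sum.remove[of "set vs" v] add.assoc)
  have "(1 - u ^ 2) ^ ?n * ?l = (1 - u ^ 2) ^ (?n + ?k) *
      det (matrix_on vs vs (\<lambda>v v'.
        (if v = v' then 1 - u ^ 2 + u ^ 2 * (\<Sum>e | e \<in> set es \<and> origin e = v. ?W e) else 0)
        - u * (\<Sum>e | e \<in> set es \<and> origin e = v \<and> terminus e = v'. ?W e)))"
    using es vs u0 len by (intro bass_formula) (auto simp: arcs_def)
  also have "matrix_on vs vs (\<lambda>v v'.
        (if v = v' then 1 - u ^ 2 + u ^ 2 * (\<Sum>e | e \<in> set es \<and> origin e = v. ?W e) else 0)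
        - u * (\<Sum>e | e \<in> set es \<and> origin e = v \<and> terminus e = v'. ?W e)) = ?R"
  proof (rule matrix_on_cong)
    fix v v' assume v: "v \<in> set vs" "v' \<in> set vs"
    show "(if v = v' then 1 - u ^ 2 + u ^ 2 * (\<Sum>e | e \<in> set es \<and> origin e = v. ?W e) else 0)
        - u * (\<Sum>e | e \<in> set es \<and> origin e = v \<and> terminus e = v'. ?W e)
      = (if v = v' then 1 - 2 * X v v * u + u ^ 2 * ((\<Sum>h\<in>set vs. X v h) + X v v - 1)
        else - u * X v v')"
      unfolding between[OF v] out[OF v(1)] by (simp add: algebra_simps)
  qed
  finally have "(1 - u ^ 2) ^ ?n * ?l = (1 - u ^ 2) ^ ?n * ((1 - u ^ 2) ^ ?k * det ?R)"
    by (simp add: power_add mult.assoc)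
  moreover have "1 - u ^ 2 \<noteq> 0"
    using u0 by (metis diff_zero poly_0 poly_1 poly_diff poly_power power_zero_numeral zero_neq_one)
  ultimately show ?thesis
    by simp
qed

section \<open>Characters of finite abelian groups\<close>

lemma in_characters_iff:
  "\<chi> \<in> characters G \<longleftrightarrow> \<chi> \<in> extensional (carrier G) \<and> (\<forall>a\<in>carrier G. \<chi> a \<noteq> 0) \<and>
    (\<forall>a\<in>carrier G. \<forall>b\<in>carrier G. \<chi> (a \<otimes>\<^bsub>G\<^esub> b) = \<chi> a * \<chi> b)"
  by (auto simp: characters_def hom_def complex_mult_group_def)

lemma ex_primitive_root_of_unity:
  assumes "n > 0"
  obtains \<omega> :: complex where "\<omega> ^ n = 1" "\<And>k. 0 < k \<Longrightarrow> k < n \<Longrightarrow> \<omega> ^ k \<noteq> 1"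
proof
  let ?\<omega> = "cis (2 * pi / real n)"
  have pow: "?\<omega> ^ k = cis (2 * pi * real k / real n)" for k
    by (simp add: DeMoivre mult_ac)
  have bij: "bij_betw (\<lambda>k. cis (2 * pi * real k / real n)) {..<n} {z. z ^ n = 1}"
    by (rule bij_betw_roots_unity[OF assms])
  show "?\<omega> ^ n = 1"
    using assms by (simp add: pow)
  show "?\<omega> ^ k \<noteq> 1" if "0 < k" "k < n" for k
    using inj_onD[OF bij_betw_imp_inj_on[OF bij], of k 0] that assms by (auto simp: pow)
qed

lemma sum_powers_root_of_unity:
  fixes w :: complex
  assumes "w ^ n = 1"
  shows "(\<Sum>j<n. w ^ j) = (if w = 1 then of_nat n else 0)"
  using assms by (auto simp: sum_gp_strict)

context comm_group
begin

text \<open>When \<open>a [^] n = \<one>\<close> and \<open>w ^ n = 1\<close>, this is \<open>n\<close> times the projection of \<open>f\<close> onto the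
  eigenspace of the translation by \<open>a\<close> with eigenvalue \<open>inverse w\<close>.\<close>

definition fourier_part :: "nat \<Rightarrow> complex \<Rightarrow> 'a \<Rightarrow> ('a \<Rightarrow> complex) \<Rightarrow> 'a \<Rightarrow> complex" where
  "fourier_part n w a f y = (\<Sum>k<n. w ^ k * f (y \<otimes> a [^] k))"

lemma fourier_part_shift:
  assumes a: "a \<in> carrier G" and y: "y \<in> carrier G" and an: "a [^] n = \<one>" and wn: "w ^ n = 1"
  shows "fourier_part n w a f (y \<otimes> a) = inverse w * fourier_part n w a f y"
proof -
  have w0: "n = 0 \<or> w \<noteq> 0"
    using wn by (cases n) auto
  define c where "c k = w ^ k * f (y \<otimes> a [^] k)" for k :: nat
  have "w * fourier_part n w a f (y \<otimes> a) = (\<Sum>k<n. c (Suc k))"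
    unfolding fourier_part_def sum_distrib_left
  proof (rule sum.cong[OF refl])
    fix k
    have "y \<otimes> a \<otimes> a [^] k = y \<otimes> a [^] Suc k"
      using a y by (simp add: m_ac)
    then show "w * (w ^ k * f (y \<otimes> a \<otimes> a [^] k)) = c (Suc k)"
      by (simp add: c_def)
  qed
  moreover have "c n = c 0"
    using an wn y by (simp add: c_def)
  moreover have "(\<Sum>k<Suc n. c k) = c 0 + (\<Sum>k<n. c (Suc k))"
    by (rule sum.lessThan_Suc_shift)
  ultimately have "w * fourier_part n w a f (y \<otimes> a) = fourier_part n w a f y"
    by (simp add: fourier_part_def c_def)
  then show ?thesis
    using w0 by (auto simp: field_simps fourier_part_def)
qed

text \<open>The Fourier parts over all \<open>n\<close>-th roots of unity sum to \<open>n * f\<close>, so they cannot all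
  vanish where \<open>f\<close> does not.\<close>

lemma ex_fourier_part_nonzero:
  assumes n: "n > 0" and a: "a \<in> carrier G" and y: "y \<in> carrier G" and f: "f y \<noteq> 0"
  obtains w where "w ^ n = 1" "fourier_part n w a f y \<noteq> 0"
proof -
  obtain \<omega> :: complex where \<omega>: "\<omega> ^ n = 1" and prim: "\<And>k. 0 < k \<Longrightarrow> k < n \<Longrightarrow> \<omega> ^ k \<noteq> 1"
    using ex_primitive_root_of_unity[OF n] by blast
  have pow1: "(\<omega> ^ k) ^ n = 1" for k
    using \<omega> by (metis mult.commute power_mult power_one)
  have "(\<Sum>j<n. fourier_part n (\<omega> ^ j) a f y)
      = (\<Sum>k<n. (\<Sum>j<n. (\<omega> ^ k) ^ j) * f (y \<otimes> a [^] k))"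
    unfolding fourier_part_def sum_distrib_right
    by (subst sum.swap) (simp add: power_mult[symmetric] mult.commute)
  also have "\<dots> = (\<Sum>k<n. if k = 0 then of_nat n * f y else 0)"
    by (rule sum.cong) (use y prim in \<open>auto simp: sum_powers_root_of_unity[OF pow1]\<close>)
  also have "\<dots> = of_nat n * f y"
    using n by simp
  finally have "(\<Sum>j<n. fourier_part n (\<omega> ^ j) a f y) \<noteq> 0"
    using n f by simp
  then obtain j where "fourier_part n (\<omega> ^ j) a f y \<noteq> 0"
    by (meson sum.not_neutral_contains_not_neutral)
  then show ?thesis
    using that pow1 by blast
qed

text \<open>Translations commute and have finite order, so they have common eigenfunctions; passing
  to a nonzero Fourier part for one more element keeps the eigenfunction property already obtained
  for the others. The point is that the eigenvalue at \<open>a\<close> can be prescribed to differ from \<open>1\<close>: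
  start from \<open>h(y) = \<delta>(y a) - \<delta>(y)\<close>, where \<open>\<delta>\<close> is the indicator of the unit. Its sum over the
  powers of \<open>a\<close> telescopes to zero, so its Fourier part for the eigenvalue \<open>1\<close> vanishes.\<close>

lemma ex_common_eigenfunction:
  assumes fin: "finite (carrier G)" and a: "a \<in> carrier G" "a \<noteq> \<one>"
    and S: "finite S" "S \<subseteq> carrier G"
  shows "\<exists>(f :: 'a \<Rightarrow> complex) w. (\<exists>y\<in>carrier G. f y \<noteq> 0) \<and> w \<noteq> 1 \<and> (\<forall>y\<in>carrier G. f (y \<otimes> a) = w * f y) \<and>
    (\<forall>g\<in>S. \<exists>\<mu>. \<forall>y\<in>carrier G. f (y \<otimes> g) = \<mu> * f y)"
  using S
proof (induction S)
  case empty
  define n where "n = Coset.order G"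
  have n: "n > 0"
    unfolding n_def using fin order_gt_0_iff_finite by blast
  have an: "a [^] n = \<one>"
    unfolding n_def using a(1) by (rule pow_order_eq_1)
  define \<delta> :: "'a \<Rightarrow> complex" where "\<delta> y = (if y = \<one> then 1 else 0)" for y
  define h where "h y = \<delta> (y \<otimes> a) - \<delta> y" for y
  have "h \<one> \<noteq> 0"
    using a by (simp add: h_def \<delta>_def)
  then obtain w where w: "w ^ n = 1" "fourier_part n w a h \<one> \<noteq> 0"
    using ex_fourier_part_nonzero[OF n a(1) one_closed] by blast
  have "w \<noteq> 1"
  proof
    assume "w = 1"
    then have "fourier_part n w a h \<one> = (\<Sum>k<n. \<delta> (a [^] Suc k) - \<delta> (a [^] k))"
      using a by (simp add: fourier_part_def h_def)
    also have "\<dots> = \<delta> (a [^] n) - \<delta> (a [^] (0::nat))"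
      by (rule sum_lessThan_telescope)
    finally show False
      using w an by simp
  qed
  then have "inverse w \<noteq> 1"
    by (metis inverse_1 inverse_inverse_eq)
  then show ?case
    using w fourier_part_shift[OF a(1) _ an w(1), of _ h]
    by (intro exI[of _ "fourier_part n w a h"] exI[of _ "inverse w"]) auto
next
  case (insert g S)
  then obtain f :: "'a \<Rightarrow> complex" and w y where y: "y \<in> carrier G" "f y \<noteq> 0" and w: "w \<noteq> 1"
    and fa: "\<And>y. y \<in> carrier G \<Longrightarrow> f (y \<otimes> a) = w * f y"
    and fS: "\<And>h. h \<in> S \<Longrightarrow> \<exists>\<mu>. \<forall>y\<in>carrier G. f (y \<otimes> h) = \<mu> * f y"
    by auto
  have g: "g \<in> carrier G"
    using insert.prems by auto
  define n where "n = Coset.order G"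
  have n: "n > 0"
    unfolding n_def using fin order_gt_0_iff_finite by blast
  have gn: "g [^] n = \<one>"
    unfolding n_def using g by (rule pow_order_eq_1)
  obtain v where v: "v ^ n = 1" "fourier_part n v g f y \<noteq> 0"
    using ex_fourier_part_nonzero[of n g y f, OF n g y] by blast
  have keep: "fourier_part n v g f (z \<otimes> b) = \<mu> * fourier_part n v g f z"
    if "b \<in> carrier G" "z \<in> carrier G" "\<forall>y\<in>carrier G. f (y \<otimes> b) = \<mu> * f y" for b \<mu> z
    unfolding fourier_part_def sum_distrib_left
  proof (rule sum.cong[OF refl])
    fix k :: nat
    have "z \<otimes> b \<otimes> g [^] k = z \<otimes> g [^] k \<otimes> b"
      using that g m_comm[of b "g [^] k"] by (simp add: m_assoc)
    then show "v ^ k * f (z \<otimes> b \<otimes> g [^] k) = \<mu> * (v ^ k * f (z \<otimes> g [^] k))"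
      using that g by simp
  qed
  have "\<exists>\<mu>. \<forall>z\<in>carrier G. fourier_part n v g f (z \<otimes> h) = \<mu> * fourier_part n v g f z"
    if "h \<in> insert g S" for h
  proof (cases "h = g")
    case True
    then show ?thesis
      using fourier_part_shift[OF g _ gn v(1)] by blast
  next
    case False
    then obtain \<mu> where "\<forall>y\<in>carrier G. f (y \<otimes> h) = \<mu> * f y"
      using fS \<open>h \<in> insert g S\<close> by blast
    moreover have "h \<in> carrier G"
      using that insert.prems by blast
    ultimately show ?thesis
      using keep by blast
  qed
  then show ?case
    using y(1) v(2) w keep[OF a(1)] fa by blast
qed

text \<open>Characters separate points: the eigenvalues of an eigenfunction common to all
  translations form a character.\<close>

lemma ex_character_nontrivial_at:
  assumes fin: "finite (carrier G)" and a: "a \<in> carrier G" "a \<noteq> \<one>"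
  obtains \<chi> where "\<chi> \<in> characters G" "\<chi> a \<noteq> 1"
proof -
  obtain f :: "'a \<Rightarrow> complex" and w y where y: "y \<in> carrier G" "f y \<noteq> 0" and w: "w \<noteq> 1"
    and fa: "\<And>y. y \<in> carrier G \<Longrightarrow> f (y \<otimes> a) = w * f y"
    and "\<forall>g\<in>carrier G. \<exists>\<mu>. \<forall>y\<in>carrier G. f (y \<otimes> g) = \<mu> * f y"
    using ex_common_eigenfunction[OF fin a fin subset_refl] by blast
  then obtain \<mu> where "\<forall>g\<in>carrier G. \<forall>y\<in>carrier G. f (y \<otimes> g) = \<mu> g * f y"
    unfolding bchoice_iff by blast
  then have f: "\<And>y g. y \<in> carrier G \<Longrightarrow> g \<in> carrier G \<Longrightarrow> f (y \<otimes> g) = \<mu> g * f y"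
    by blast
  have \<mu>: "f g = \<mu> g * f \<one>" if "g \<in> carrier G" for g
    using f[OF one_closed that] that by simp
  have f1: "f \<one> \<noteq> 0"
    using \<mu>[OF y(1)] y(2) by (metis mult_zero_right)
  have mult: "\<mu> (g \<otimes> h) = \<mu> g * \<mu> h" if "g \<in> carrier G" "h \<in> carrier G" for g h
    using f[OF that] \<mu>[OF that(1)] \<mu>[of "g \<otimes> h"] that f1 by simp
  have \<mu>1: "\<mu> \<one> = 1"
    using \<mu>[OF one_closed] f1 by simp
  have nz: "\<mu> g \<noteq> 0" if "g \<in> carrier G" for g
    using mult[OF that inv_closed[OF that]] \<mu>1 that by auto
  have "\<mu> a = w"
    using fa[OF one_closed] \<mu>[OF a(1)] a f1 by simp
  then have "restrict \<mu> (carrier G) a \<noteq> 1"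
    using a w by simp
  moreover have "restrict \<mu> (carrier G) \<in> characters G"
    using mult nz by (auto simp: in_characters_iff)
  ultimately show ?thesis
    using that by blast
qed

lemma character_one: "\<chi> \<in> characters G \<Longrightarrow> \<chi> \<one> = 1"
  using one_closed r_one[OF one_closed] by (force simp: in_characters_iff)

lemma sum_multiplicative_function:
  fixes \<phi> :: "'a \<Rightarrow> complex"
  assumes mult: "\<And>g h. g \<in> carrier G \<Longrightarrow> h \<in> carrier G \<Longrightarrow> \<phi> (g \<otimes> h) = \<phi> g * \<phi> h"
    and a: "a \<in> carrier G" "\<phi> a \<noteq> 1"
  shows "(\<Sum>g\<in>carrier G. \<phi> g) = 0"
proof -
  have "(\<Sum>g\<in>carrier G. \<phi> g) = (\<Sum>g\<in>carrier G. \<phi> (a \<otimes> g))"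
    using sum.reindex_bij_betw[of "\<lambda>g. a \<otimes> g" "carrier G" "carrier G" \<phi>] a(1)
    by (simp add: bij_betw_def inj_on_multc inj_on_cmult surj_const_mult)
  also have "\<dots> = \<phi> a * (\<Sum>g\<in>carrier G. \<phi> g)"
    using mult a(1) by (simp add: sum_distrib_left)
  finally show ?thesis
    using a(2) by simp
qed

text \<open>Multiplication by a character that is nontrivial at \<open>a\<close> permutes the characters and
  multiplies the sum by a number other than \<open>1\<close>.\<close>

lemma sum_over_characters:
  assumes fin: "finite (carrier G)" and a: "a \<in> carrier G"
  shows "(\<Sum>\<chi>\<in>characters G. \<chi> a) = (if a = \<one> then of_nat (card (characters G)) else 0)"
proof (cases "a = \<one>")
  case False
  obtain \<psi> where \<psi>: "\<psi> \<in> characters G" "\<psi> a \<noteq> 1"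
    using ex_character_nontrivial_at[OF fin a False] by blast
  define T where "T \<chi> = restrict (\<lambda>g. \<psi> g * \<chi> g) (carrier G)" for \<chi>
  have "T ` characters G \<subseteq> characters G"
    using \<psi>(1) by (auto simp: T_def in_characters_iff)
  moreover have "inj_on T (characters G)"
  proof (rule inj_onI)
    fix \<chi> \<chi>' assume *: "\<chi> \<in> characters G" "\<chi>' \<in> characters G" and eq: "T \<chi> = T \<chi>'"
    have "\<chi> g = \<chi>' g" if "g \<in> carrier G" for g
      using fun_cong[OF eq, of g] \<psi>(1) that by (auto simp: T_def in_characters_iff)
    with * show "\<chi> = \<chi>'"
      by (intro extensionalityI[of _ "carrier G"]) (auto simp: in_characters_iff)
  qed
  ultimately have "bij_betw T (characters G) (characters G)"
    using finite_characters[OF is_group fin] by (simp add: bij_betw_def endo_inj_surj)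
  then have "(\<Sum>\<chi>\<in>characters G. \<chi> a) = (\<Sum>\<chi>\<in>characters G. T \<chi> a)"
    by (rule sum.reindex_bij_betw[symmetric])
  also have "\<dots> = \<psi> a * (\<Sum>\<chi>\<in>characters G. \<chi> a)"
    using a by (simp add: T_def sum_distrib_left)
  finally show ?thesis
    using \<psi>(2) False by simp
qed (simp add: character_one)

text \<open>Orthogonality of characters. With \<open>\<chi> (inv g)\<close> in place of the complex conjugate of
  \<open>\<chi> g\<close>, the summand is again multiplicative in \<open>g\<close>, and the relation survives ring
  homomorphisms out of the complex numbers.\<close>

lemma sum_character_quotient:
  assumes \<chi>: "\<chi> \<in> characters G" and \<psi>: "\<psi> \<in> characters G"
  shows "(\<Sum>g\<in>carrier G. \<chi> (inv g) * \<psi> g) = (if \<chi> = \<psi> then of_nat (Coset.order G) else 0)"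
proof -
  have inv: "\<chi> (inv g) * \<chi> g = 1" if "g \<in> carrier G" for g
  proof -
    have "\<chi> (inv g \<otimes> g) = \<chi> (inv g) * \<chi> g"
      using \<chi> that unfolding in_characters_iff by blast
    then show ?thesis
      using that character_one[OF \<chi>] by simp
  qed
  show ?thesis
  proof (cases "\<chi> = \<psi>")
    case True
    then show ?thesis
      using inv by (simp add: Coset.order_def)
  next
    case False
    then obtain a where a: "a \<in> carrier G" "\<chi> a \<noteq> \<psi> a"
      using \<chi> \<psi> by (meson extensionalityI in_characters_iff)
    have "\<chi> (inv a) * \<psi> a \<noteq> 1"
    proof
      assume "\<chi> (inv a) * \<psi> a = 1"
      with inv[OF a(1)] have "\<chi> (inv a) * (\<chi> a - \<psi> a) = 0" and "\<chi> (inv a) \<noteq> 0"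
        by (auto simp: right_diff_distrib)
      with a(2) show False
        by simp
    qed
    then have "(\<Sum>g\<in>carrier G. \<chi> (inv g) * \<psi> g) = 0"
      using \<chi> \<psi> by (intro sum_multiplicative_function[OF _ a(1)])
        (auto simp: in_characters_iff inv_mult)
    then show ?thesis
      using False by simp
  qed
qed

text \<open>Evaluate the sum of \<open>\<chi> g\<close> over all pairs in both orders: summing over \<open>g\<close> first, only the
  trivial character contributes; summing over \<open>\<chi>\<close> first, only the unit does.\<close>

lemma card_characters:
  assumes fin: "finite (carrier G)"
  shows "card (characters G) = Coset.order G"
proof -
  let ?\<epsilon> = "restrict (\<lambda>_. 1) (carrier G) :: 'a \<Rightarrow> complex"
  have \<epsilon>: "?\<epsilon> \<in> characters G"
    by (auto simp: in_characters_iff)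
  have "(\<Sum>\<chi>\<in>characters G. \<Sum>g\<in>carrier G. \<chi> g) = (\<Sum>\<chi>\<in>characters G. if ?\<epsilon> = \<chi> then of_nat (Coset.order G) else 0)"
  proof (rule sum.cong[OF refl])
    fix \<chi> assume "\<chi> \<in> characters G"
    from sum_character_quotient[OF \<epsilon> this]
    show "(\<Sum>g\<in>carrier G. \<chi> g) = (if ?\<epsilon> = \<chi> then of_nat (Coset.order G) else 0)"
      by simp
  qed
  also have "\<dots> = of_nat (Coset.order G)"
    using finite_characters[OF is_group fin] \<epsilon> by simp
  finally have "of_nat (Coset.order G) = (\<Sum>g\<in>carrier G. \<Sum>\<chi>\<in>characters G. \<chi> g)"
    by (simp add: sum.swap[of _ "carrier G"])
  also have "\<dots> = of_nat (card (characters G))"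
    using fin by (simp add: sum_over_characters)
  finally show ?thesis
    using of_nat_eq_iff by metis
qed

end

section \<open>The group determinant\<close>

text \<open>Dedekind's factorization of the group determinant of an abelian group. Let \<open>M\<close> be the
  group matrix and \<open>X\<close> the character table; each column of \<open>X\<close> is an eigenvector of \<open>M\<close>, so \<open>M X = X D\<close>
  with \<open>D\<close> diagonal. The table is square because there are as many characters as elements, and
  orthogonality gives \<open>Y X = n I\<close> for the table \<open>Y\<close> of inverse values, so \<open>det X\<close> is nonzero and can
  be cancelled. The homomorphism \<open>\<phi>\<close> moves the complex character values into the ring of the matrix
  entries.\<close>

lemma (in comm_group) det_group_matrix:
  fixes f :: "'a \<Rightarrow> 'r :: idom" and \<phi> :: "complex \<Rightarrow> 'r"
  assumes gs: "distinct gs" "set gs = carrier G" and \<phi>: "comm_ring_hom \<phi>"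
  shows "det (matrix_on gs gs (\<lambda>a b. f (inv a \<otimes> b)))
    = (\<Prod>\<chi>\<in>characters G. \<Sum>h\<in>carrier G. f h * \<phi> (\<chi> h))"
proof -
  interpret \<phi>: comm_ring_hom \<phi> by fact
  have fin: "finite (carrier G)"
    using gs(2) by (metis finite_set)
  obtain cs where cs: "distinct cs" "set cs = characters G"
    using finite_distinct_list[OF finite_characters[OF is_group fin]] by blast
  have len: "length cs = length gs"
    using card_characters[OF fin] gs cs by (metis distinct_card Coset.order_def)
  let ?M = "matrix_on gs gs (\<lambda>a b. f (inv a \<otimes> b))"
  let ?X = "matrix_on gs cs (\<lambda>a \<chi>. \<phi> (\<chi> a))"
  let ?Y = "matrix_on cs gs (\<lambda>\<chi> a. \<phi> (\<chi> (inv a)))"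
  let ?ev = "\<lambda>\<chi>. \<Sum>h\<in>carrier G. f h * \<phi> (\<chi> h)"
  let ?D = "matrix_on cs cs (\<lambda>\<chi> \<psi>. if \<chi> = \<psi> then ?ev \<chi> else 0)"
  let ?N = "of_nat (Coset.order G) :: complex"
  have YX: "?Y * ?X = matrix_on cs cs (\<lambda>\<chi> \<psi>. if \<chi> = \<psi> then \<phi> ?N else 0)"
    unfolding matrix_on_mult[OF gs(1)]
  proof (rule matrix_on_cong)
    fix \<chi> \<psi> assume "\<chi> \<in> set cs" "\<psi> \<in> set cs"
    then have "(\<Sum>g\<in>carrier G. \<chi> (inv g) * \<psi> g) = (if \<chi> = \<psi> then ?N else 0)"
      unfolding cs(2) by (rule sum_character_quotient)
    from arg_cong[OF this, of \<phi>]
    show "(\<Sum>a\<in>set gs. \<phi> (\<chi> (inv a)) * \<phi> (\<psi> a)) = (if \<chi> = \<psi> then \<phi> ?N else 0)"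
      by (simp add: gs(2) \<phi>.hom_sum \<phi>.hom_mult split: if_splits)
  qed
  have "\<phi> ?N * \<phi> (inverse ?N) = 1"
    using fin order_gt_0_iff_finite by (simp flip: \<phi>.hom_mult)
  then have "\<phi> ?N \<noteq> 0"
    by auto
  then have "det (?Y * ?X) \<noteq> 0"
    unfolding YX by (simp add: det_matrix_on_diagonal[OF cs(1)])
  have MX: "?M * ?X = matrix_on gs cs (\<lambda>a \<chi>. \<phi> (\<chi> a) * ?ev \<chi>)"
    unfolding matrix_on_mult[OF gs(1)]
  proof (rule matrix_on_cong)
    fix a \<chi> assume "a \<in> set gs" "\<chi> \<in> set cs"
    then have a: "a \<in> carrier G" and \<chi>: "\<chi> \<in> characters G"
      by (simp_all add: gs cs)
    have "(\<Sum>b\<in>carrier G. f (inv a \<otimes> b) * \<phi> (\<chi> b))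
        = (\<Sum>h\<in>carrier G. f h * \<phi> (\<chi> (a \<otimes> h)))"
      by (rule sum.reindex_bij_witness[of _ "\<lambda>h. a \<otimes> h" "\<lambda>b. inv a \<otimes> b"])
        (use a in \<open>auto simp flip: m_assoc\<close>)
    also have "\<dots> = \<phi> (\<chi> a) * ?ev \<chi>"
      unfolding sum_distrib_left
      by (rule sum.cong) (use a \<chi> in \<open>auto simp: in_characters_iff \<phi>.hom_mult\<close>)
    finally show "(\<Sum>b\<in>set gs. f (inv a \<otimes> b) * \<phi> (\<chi> b)) = \<phi> (\<chi> a) * ?ev \<chi>"
      by (simp add: gs(2))
  qed
  also have "\<dots> = ?X * ?D"
    unfolding matrix_on_mult[OF cs(1)]
    by (rule matrix_on_cong) (simp add: if_distrib[of "\<lambda>c. _ * c"] cong: if_cong)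
  finally have "?M * ?X = ?X * ?D" .
  have X: "?X \<in> carrier_mat (length gs) (length gs)" and Y: "?Y \<in> carrier_mat (length gs) (length gs)"
    and D: "?D \<in> carrier_mat (length gs) (length gs)"
    using matrix_on_carrier[of gs cs] matrix_on_carrier[of cs gs] matrix_on_carrier[of cs cs]
    unfolding len by blast+
  have "det ?M * det ?X = det ?X * det ?D"
    using \<open>?M * ?X = ?X * ?D\<close> det_mult[OF matrix_on_carrier X] det_mult[OF X D] by metis
  moreover have "det ?X \<noteq> 0"
    using \<open>det (?Y * ?X) \<noteq> 0\<close> det_mult[OF Y X] by auto
  ultimately have "det ?M = det ?D"
    by simp
  then show ?thesis
    by (simp add: det_matrix_on_diagonal[OF cs(1)] cs(2))
qed

section \<open>The zeta function of the complete graph on a group\<close>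

lemma inverse_Z1:
  fixes w :: "'a arc \<Rightarrow> 'r :: idom"
  assumes "distinct es"
  shows "inverse (Z1 es w) = to_fract (det (matrix_on es es (\<lambda>e f. (if e = f then 1 else 0)
    - uvar * ((if terminus e = origin f then [:w f:] else 0) - (if f = arc_inv e then 1 else 0)))))"
proof -
  have "1\<^sub>m (length es) - uvar \<cdot>\<^sub>m map_mat (\<lambda>c. [:c:]) (B_mat es w - J0_mat es)
      = matrix_on es es (\<lambda>e f. (if e = f then 1 else 0)
        - uvar * ((if terminus e = origin f then [:w f:] else 0) - (if f = arc_inv e then 1 else 0)))"
    using assms
    by (intro eq_matI) (auto simp: matrix_on_def B_mat_def J0_mat_def arc_matrix_def
        nth_eq_iff_index_eq one_pCons)
  then show ?thesis
    by (simp add: Z1_def)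
qed

lemma comm_ring_hom_const: "comm_ring_hom (\<lambda>c. [:const c:])"
  by unfold_locales (simp_all add: const_def single_add mult_single one_pCons mult.commute)

text \<open>The vertex matrix of the complete graph is the group matrix of the function \<open>?f\<close>, because
  its diagonal entries do not depend on the vertex; its determinant is therefore a product over the
  characters.\<close>

theorem theorem7:
  fixes \<Gamma> :: "('a, 'm) monoid_scheme"
    and g :: "nat \<Rightarrow> 'a"
    and n :: nat
    and es :: "'a arc list"
    and x :: "'a \<Rightarrow> cpoly"
  assumes "comm_group \<Gamma>"
    and "finite (carrier \<Gamma>)"
    and "Coset.order \<Gamma> = n"
    and "bij_betw g {1..n} (carrier \<Gamma>)"
    and "g 1 = \<one>\<^bsub>\<Gamma>\<^esub>"
    and "distinct es"
    and "set es = arcs (carrier \<Gamma>)"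
    and "x = group_indet g n"
  shows "inverse (Z1 es (group_weight \<Gamma> x)) =
    to_fract ((1 - uvar ^ 2) ^ (n * (n - 1) div 2) *
      (\<Prod>\<chi>\<in>characters \<Gamma>.
        1 - 2 * [:x \<one>\<^bsub>\<Gamma>\<^esub>:] * uvar
          - uvar * (\<Sum>h\<in>carrier \<Gamma> - {\<one>\<^bsub>\<Gamma>\<^esub>}. [:const (\<chi> h) * x h:])
          + uvar ^ 2 * ((\<Sum>h\<in>carrier \<Gamma>. [:x h:]) + [:x \<one>\<^bsub>\<Gamma>\<^esub>:] - 1)))"
proof -
  interpret comm_group \<Gamma> by fact
  let ?s = "\<Sum>h\<in>carrier \<Gamma>. [:x h:]"
  let ?f = "\<lambda>h. if h = \<one>\<^bsub>\<Gamma>\<^esub>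
      then 1 - 2 * [:x \<one>\<^bsub>\<Gamma>\<^esub>:] * uvar + uvar ^ 2 * (?s + [:x \<one>\<^bsub>\<Gamma>\<^esub>:] - 1)
      else - uvar * [:x h:]"
  let ?X = "\<lambda>v h. [:x (inv\<^bsub>\<Gamma>\<^esub> v \<otimes>\<^bsub>\<Gamma>\<^esub> h):]"
  obtain gs where gs: "distinct gs" "set gs = carrier \<Gamma>"
    using finite_distinct_list[OF assms(2)] by blast
  have len: "length gs = n"
    using gs assms(3) by (metis distinct_card Coset.order_def)
  have "inverse (Z1 es (group_weight \<Gamma> x))
      = to_fract (det (matrix_on es es (\<lambda>e f. (if e = f then 1 else 0)
        - uvar * ((if terminus e = origin f then ?X (origin f) (terminus f) else 0)
          - (if f = arc_inv e then 1 else 0)))))"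
    unfolding inverse_Z1[OF assms(6)] group_weight_def ..
  also have "\<dots> = to_fract ((1 - uvar ^ 2) ^ (n * (n - 1) div 2) *
      det (matrix_on gs gs (\<lambda>v v'. if v = v'
        then 1 - 2 * ?X v v * uvar + uvar ^ 2 * ((\<Sum>h\<in>set gs. ?X v h) + ?X v v - 1)
        else - uvar * ?X v v')))"
    using assms(6,7) gs by (subst bass_formula_complete_graph[where vs = gs]) (simp_all add: uvar_def len)
  also have "matrix_on gs gs (\<lambda>v v'. if v = v'
        then 1 - 2 * ?X v v * uvar + uvar ^ 2 * ((\<Sum>h\<in>set gs. ?X v h) + ?X v v - 1)
        else - uvar * ?X v v') = matrix_on gs gs (\<lambda>v v'. ?f (inv\<^bsub>\<Gamma>\<^esub> v \<otimes>\<^bsub>\<Gamma>\<^esub> v'))"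
  proof (rule matrix_on_cong)
    fix v v' assume "v \<in> set gs" "v' \<in> set gs"
    then have v: "v \<in> carrier \<Gamma>" "v' \<in> carrier \<Gamma>"
      by (simp_all add: gs)
    have "(\<Sum>h\<in>carrier \<Gamma>. ?X v h) = ?s"
      by (rule sum.reindex_bij_witness[of _ "\<lambda>h. v \<otimes>\<^bsub>\<Gamma>\<^esub> h" "\<lambda>h. inv\<^bsub>\<Gamma>\<^esub> v \<otimes>\<^bsub>\<Gamma>\<^esub> h"])
        (use v in \<open>auto simp flip: m_assoc\<close>)
    moreover have "v = v' \<longleftrightarrow> inv\<^bsub>\<Gamma>\<^esub> v \<otimes>\<^bsub>\<Gamma>\<^esub> v' = \<one>\<^bsub>\<Gamma>\<^esub>"
      using v by (metis inv_closed inv_inv inv_equality l_inv)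
    ultimately show "(if v = v'
        then 1 - 2 * ?X v v * uvar + uvar ^ 2 * ((\<Sum>h\<in>set gs. ?X v h) + ?X v v - 1)
        else - uvar * ?X v v') = ?f (inv\<^bsub>\<Gamma>\<^esub> v \<otimes>\<^bsub>\<Gamma>\<^esub> v')"
      using v by (simp add: gs)
  qed
  also have "det \<dots> = (\<Prod>\<chi>\<in>characters \<Gamma>. \<Sum>h\<in>carrier \<Gamma>. ?f h * [:const (\<chi> h):])"
    using gs comm_ring_hom_const by (rule det_group_matrix)
  also have "\<dots> = (\<Prod>\<chi>\<in>characters \<Gamma>.
        1 - 2 * [:x \<one>\<^bsub>\<Gamma>\<^esub>:] * uvar
          - uvar * (\<Sum>h\<in>carrier \<Gamma> - {\<one>\<^bsub>\<Gamma>\<^esub>}. [:const (\<chi> h) * x h:])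
          + uvar ^ 2 * (?s + [:x \<one>\<^bsub>\<Gamma>\<^esub>:] - 1))"
  proof (rule prod.cong[OF refl])
    fix \<chi> assume \<chi>: "\<chi> \<in> characters \<Gamma>"
    have "(\<Sum>h\<in>carrier \<Gamma>. ?f h * [:const (\<chi> h):])
        = ?f \<one>\<^bsub>\<Gamma>\<^esub> * [:const (\<chi> \<one>\<^bsub>\<Gamma>\<^esub>):]
          + (\<Sum>h\<in>carrier \<Gamma> - {\<one>\<^bsub>\<Gamma>\<^esub>}. ?f h * [:const (\<chi> h):])"
      using assms(2) by (rule sum.remove) simp
    also have "[:const (\<chi> \<one>\<^bsub>\<Gamma>\<^esub>):] = 1"
      using character_one[OF \<chi>] by (simp add: const_def one_pCons)
    also have "(\<Sum>h\<in>carrier \<Gamma> - {\<one>\<^bsub>\<Gamma>\<^esub>}. ?f h * [:const (\<chi> h):])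
        = - uvar * (\<Sum>h\<in>carrier \<Gamma> - {\<one>\<^bsub>\<Gamma>\<^esub>}. [:const (\<chi> h) * x h:])"
      unfolding sum_distrib_left by (rule sum.cong) (simp_all add: mult.commute)
    finally show "(\<Sum>h\<in>carrier \<Gamma>. ?f h * [:const (\<chi> h):])
        = 1 - 2 * [:x \<one>\<^bsub>\<Gamma>\<^esub>:] * uvar
          - uvar * (\<Sum>h\<in>carrier \<Gamma> - {\<one>\<^bsub>\<Gamma>\<^esub>}. [:const (\<chi> h) * x h:])
          + uvar ^ 2 * (?s + [:x \<one>\<^bsub>\<Gamma>\<^esub>:] - 1)"
      by (simp add: algebra_simps)
  qed
  finally show ?thesis .
qed

end
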